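(* Let $p$ be a prime. For every finite subgroup $\Gamma$ of $\mathrm{PGL}_2(\bar{\mathbb{F}}_p)$ there exists an endomorphism $f$ of $\mathbb{P}^1$ over $\bar{\mathbb{F}}_p$ of degree at least $2$ such that $\mathrm{Aut}(f)=\Gamma$.
   Context: A dynamical system of degree $d\ge 2$ on $\mathbb{P}^1$ over an algebraically closed field $K$ is an endomorphism $f$ of $\mathbb{P}^1$ given by a pair of homogeneous polynomials of degree $d$ in two variables over $K$ without common factor. For $\alpha\in \mathrm{PGL}_2(K)$ put $f^\alpha=\alpha^{-1}\circ f\circ\alpha$. The automorphism group of $f$ is $\mathrm{Aut}(f)=\{\alpha\in \mathrm{PGL}_2(K): f^\alpha=f\}$. Here $K=\bar{\mathbb{F}}_p$. *)

theory Defs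
  imports "HOL-Algebra.Algebraic_Closure_Type" "HOL-Analysis.Analysis"
begin

section \<open>The projective line\<close>

definition proj_rel :: "'k::field ^ 2 \<Rightarrow> 'k ^ 2 \<Rightarrow> bool" where
  "proj_rel v w \<longleftrightarrow> v \<noteq> 0 \<and> (\<exists>c. c \<noteq> 0 \<and> w = c *s v)"

lemma part_equivp_proj_rel: "part_equivp (proj_rel :: 'k::field ^ 2 \<Rightarrow> _)"
proof (rule part_equivpI)
  show "\<exists>x::'k^2. proj_rel x x"
    by (rule exI[of _ "axis 1 1"]) (auto simp: proj_rel_def axis_eq_0_iff intro!: exI[of _ 1])
  show "symp (proj_rel :: 'k ^ 2 \<Rightarrow> _)"
  proof (rule sympI)
    fix v w :: "'k^2" assume "proj_rel v w"
    then obtain c where c: "v \<noteq> 0" "c \<noteq> 0" "w = c *s v" by (auto simp: proj_rel_def)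
    then have "v = inverse c *s w" by simp
    with c show "proj_rel w v"
      unfolding proj_rel_def by (metis nonzero_imp_inverse_nonzero vector_mul_eq_0)
  qed
  show "transp (proj_rel :: 'k ^ 2 \<Rightarrow> _)"
  proof (rule transpI)
    fix u v w :: "'k^2" assume "proj_rel u v" "proj_rel v w"
    then obtain c c' where "u \<noteq> 0" "c \<noteq> 0" "c' \<noteq> 0" "w = (c' * c) *s u"
      by (auto simp: proj_rel_def)
    then show "proj_rel u w" unfolding proj_rel_def by (metis mult_eq_0_iff)
  qed
qed

text \<open>
  A point of \<open>P\<^sup>1(K)\<close> is a class of nonzero vectors up to nonzero scalars;
  \<open>proj_pt v\<close> is only meaningful for nonzero \<open>v\<close>.
\<close>

quotient_type (overloaded) 'k proj_line = "'k::field ^ 2" / partial: proj_rel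
  by (rule part_equivp_proj_rel)

definition proj_pt :: "'k::field ^ 2 \<Rightarrow> 'k proj_line" where
  "proj_pt v = abs_proj_line v"

lemma proj_pt_eq_iff:
  fixes v w :: "'k::field ^ 2"
  assumes "v \<noteq> 0" "w \<noteq> 0"
  shows "proj_pt v = proj_pt w \<longleftrightarrow> (\<exists>c. c \<noteq> 0 \<and> w = c *s v)"
proof -
  have refl: "proj_rel u u" if "u \<noteq> 0" for u :: "'k^2"
    using that by (auto simp: proj_rel_def intro!: exI[of _ 1])
  show ?thesis
    using Quotient3_rel[OF Quotient3_proj_line, of v w] refl[OF assms(1)] refl[OF assms(2)] assms
    by (auto simp: proj_pt_def proj_rel_def)
qed

lemma proj_pt_cases:
  fixes x :: "'k::field proj_line"
  obtains v where "v \<noteq> 0" "x = proj_pt v"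
proof -
  have "proj_rel (rep_proj_line x) (rep_proj_line x)" "abs_proj_line (rep_proj_line x) = x"
    using Quotient3_rep_reflp[OF Quotient3_proj_line] Quotient3_abs_rep[OF Quotient3_proj_line]
    by auto
  with that[of "rep_proj_line x"] show ?thesis by (auto simp: proj_pt_def proj_rel_def)
qed

section \<open>The group \<open>PGL\<^sub>2(K)\<close> and its action\<close>

definition GL2 :: "('k::field ^ 2 ^ 2) monoid" where
  "GL2 = \<lparr>carrier = {A. invertible A}, monoid.mult = (**), one = mat 1\<rparr>"

definition scalars2 :: "('k::field ^ 2 ^ 2) set" where
  "scalars2 = {mat c | c. c \<noteq> 0}"

definition PGL2 :: "('k::field ^ 2 ^ 2) set monoid" where
  "PGL2 = GL2 Mod scalars2"

lemma group_GL2: "group (GL2 :: ('k::field ^ 2 ^ 2) monoid)"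
proof (rule groupI)
  fix A :: "'k ^ 2 ^ 2" assume "A \<in> carrier GL2"
  then obtain B where "A ** B = mat 1" "B ** A = mat 1" by (auto simp: GL2_def invertible_def)
  then show "\<exists>B\<in>carrier GL2. B \<otimes>\<^bsub>GL2\<^esub> A = \<one>\<^bsub>GL2\<^esub>"
    by (auto simp: GL2_def invertible_def)
qed (auto simp: GL2_def invertible_mult matrix_mul_assoc invertible_def[of "mat 1"])

lemma mat_mult_left: "mat c ** A = (\<chi> i. c *s (A $ i))" for A :: "'k::field ^ 2 ^ 2"
  by (auto simp: matrix_matrix_mult_def mat_def vec_eq_iff UNIV_2 forall_2)

lemma mat_mult_right: "A ** mat c = (\<chi> i. c *s (A $ i))" for A :: "'k::field ^ 2 ^ 2"
  by (auto simp: matrix_matrix_mult_def mat_def vec_eq_iff UNIV_2 forall_2)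

lemma mat_mult_mat: "mat c ** mat d = (mat (c * d) :: 'k::field ^ 2 ^ 2)"
  by (auto simp: matrix_matrix_mult_def mat_def vec_eq_iff UNIV_2 forall_2)

lemma invertible_mat: "c \<noteq> 0 \<Longrightarrow> invertible (mat c :: 'k::field ^ 2 ^ 2)"
  unfolding invertible_def by (rule exI[of _ "mat (inverse c)"]) (simp add: mat_mult_mat)

lemma mat_mult_vec: "mat c *v v = c *s v" for v :: "'k::field ^ 2"
  by (auto simp: matrix_vector_mult_def mat_def vec_eq_iff UNIV_2 forall_2)

lemma normal_scalars2: "scalars2 \<lhd> (GL2 :: ('k::field ^ 2 ^ 2) monoid)"
proof -
  interpret group "GL2 :: ('k ^ 2 ^ 2) monoid" by (rule group_GL2)
  have "subgroup scalars2 (GL2 :: ('k ^ 2 ^ 2) monoid)"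
  proof (rule subgroupI)
    show "scalars2 \<subseteq> carrier (GL2 :: ('k ^ 2 ^ 2) monoid)"
      by (auto simp: scalars2_def GL2_def invertible_mat)
    show "scalars2 \<noteq> ({} :: ('k ^ 2 ^ 2) set)"
      by (auto simp: scalars2_def intro!: exI[of _ 1])
    fix a b :: "'k ^ 2 ^ 2" assume "a \<in> scalars2"
    then obtain c where c: "a = mat c" "c \<noteq> 0" by (auto simp: scalars2_def)
    have "inv\<^bsub>GL2\<^esub> a = mat (inverse c)"
      by (rule inv_equality) (use c in \<open>auto simp: GL2_def mat_mult_mat invertible_mat\<close>)
    with c show "inv\<^bsub>GL2\<^esub> a \<in> scalars2" by (auto simp: scalars2_def)
    assume "b \<in> scalars2"
    with c show "a \<otimes>\<^bsub>GL2\<^esub> b \<in> scalars2"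
      by (auto simp: scalars2_def GL2_def mat_mult_mat)
  qed
  then show ?thesis
    by (rule normalI)
       (auto simp: r_coset_def l_coset_def scalars2_def GL2_def mat_mult_left mat_mult_right)
qed

lemma group_PGL2: "group (PGL2 :: ('k::field ^ 2 ^ 2) set monoid)"
  unfolding PGL2_def by (rule normal.factorgroup_is_group[OF normal_scalars2])

text \<open>The class of \<open>A\<close> sends \<open>proj_pt v\<close> to \<open>proj_pt (A *v v)\<close>;
  independence of the representatives is \<open>pgl_act_coset\<close> below.\<close>

definition pgl_act :: "('k::field ^ 2 ^ 2) set \<Rightarrow> 'k proj_line \<Rightarrow> 'k proj_line" where
  "pgl_act \<alpha> x = (THE y. \<exists>A\<in>\<alpha>. \<exists>v. v \<noteq> 0 \<and> x = proj_pt v \<and> y = proj_pt (A *v v))"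

lemma pgl_act_coset:
  fixes A :: "'k::field ^ 2 ^ 2"
  assumes A: "invertible A" and v: "v \<noteq> 0"
  shows "pgl_act (scalars2 #>\<^bsub>GL2\<^esub> A) (proj_pt v) = proj_pt (A *v v)"
  unfolding pgl_act_def
proof (rule the_equality)
  have nz: "A *v w \<noteq> 0" if "w \<noteq> 0" for w
    using A that by (metis invertible_def matrix_vector_mul_assoc matrix_vector_mul_lid
        matrix_vector_mult_0_right)
  have "mat 1 ** A \<in> scalars2 #>\<^bsub>GL2\<^esub> A"
    by (auto simp: r_coset_def scalars2_def GL2_def) (metis matrix_mul_lid zero_neq_one)
  then show "\<exists>B\<in>scalars2 #>\<^bsub>GL2\<^esub> A. \<exists>w. w \<noteq> 0 \<and> proj_pt v = proj_pt w
      \<and> proj_pt (A *v v) = proj_pt (B *v w)"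
    using v by auto
  fix y assume "\<exists>B\<in>scalars2 #>\<^bsub>GL2\<^esub> A. \<exists>w. w \<noteq> 0 \<and> proj_pt v = proj_pt w
      \<and> y = proj_pt (B *v w)"
  then obtain c w where w: "c \<noteq> 0" "w \<noteq> 0" "proj_pt v = proj_pt w"
      "y = proj_pt ((mat c ** A) *v w)"
    by (auto simp: r_coset_def scalars2_def GL2_def)
  obtain d where d: "d \<noteq> 0" "w = d *s v" using w v by (auto simp: proj_pt_eq_iff)
  have "(mat c ** A) *v w = (c * d) *s (A *v v)"
    by (simp add: d(2) matrix_vector_mul_assoc[symmetric] mat_mult_vec vec.scale)
  then have "proj_pt (A *v v) = proj_pt ((mat c ** A) *v w)"
    using w d v nz by (subst proj_pt_eq_iff) (auto intro!: exI[of _ "c * d"])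
  with w show "y = proj_pt (A *v v)" by simp
qed

section \<open>Endomorphisms of the projective line and their automorphisms\<close>

text \<open>
  Polynomials in two variables \<open>X\<close>, \<open>Y\<close> are elements of \<open>K[X][Y]\<close>: the coefficient of
  \<open>X\<^sup>i Y\<^sup>j\<close> in \<open>F\<close> is \<open>coeff (coeff F j) i\<close>.
\<close>

definition homogeneous2 :: "nat \<Rightarrow> 'k::field poly poly \<Rightarrow> bool" where
  "homogeneous2 d F \<longleftrightarrow> (\<forall>i j. coeff (coeff F j) i \<noteq> 0 \<longrightarrow> i + j = d)"

definition eval2 :: "'k::field poly poly \<Rightarrow> 'k ^ 2 \<Rightarrow> 'k" where
  "eval2 F v = poly (poly F [:v $ 2:]) (v $ 1)"

text \<open>
  Over the algebraically closed field \<open>K\<close>, a morphism is identified with the map it induces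
  on \<open>P\<^sup>1(K)\<close>. Coprime forms of the same degree have no common zero other than \<open>0\<close>, see
  \<open>coprime_forms_no_common_zero\<close> below, so \<open>proj_pt\<close> is applied to a nonzero vector here.
\<close>

definition proj_endo :: "nat \<Rightarrow> ('k::alg_closed_field proj_line \<Rightarrow> 'k proj_line) \<Rightarrow> bool" where
  "proj_endo d f \<longleftrightarrow> (\<exists>F G. homogeneous2 d F \<and> homogeneous2 d G \<and> coprime F G \<and>
     (\<forall>v. v \<noteq> 0 \<longrightarrow> f (proj_pt v) = proj_pt (vector [eval2 F v, eval2 G v])))"

definition conj_endo :: "('k::field proj_line \<Rightarrow> 'k proj_line) \<Rightarrow> ('k ^ 2 ^ 2) set
    \<Rightarrow> 'k proj_line \<Rightarrow> 'k proj_line" where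
  "conj_endo f \<alpha> = pgl_act (inv\<^bsub>PGL2\<^esub> \<alpha>) \<circ> f \<circ> pgl_act \<alpha>"

definition Aut :: "('k::field proj_line \<Rightarrow> 'k proj_line) \<Rightarrow> ('k ^ 2 ^ 2) set set" where
  "Aut f = {\<alpha> \<in> carrier PGL2. conj_endo f \<alpha> = f}"

lemma poly_homogeneous2:
  fixes F :: "'k::field poly poly"
  assumes "homogeneous2 d F"
  shows "poly F q = (\<Sum>j\<le>d. monom (coeff (coeff F j) (d - j)) (d - j) * q ^ j)"
proof -
  have c: "coeff F j = (if j \<le> d then monom (coeff (coeff F j) (d - j)) (d - j) else 0)" for j
    using assms by (intro poly_eqI) (force simp: homogeneous2_def)
  have "degree F \<le> d"
    by (intro degree_le allI impI) (subst c, simp)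
  then have "poly F q = (\<Sum>j\<le>d. coeff F j * q ^ j)"
    unfolding poly_altdef by (intro sum.mono_neutral_left) (auto simp: coeff_eq_0)
  also have "\<dots> = (\<Sum>j\<le>d. monom (coeff (coeff F j) (d - j)) (d - j) * q ^ j)"
    by (rule sum.cong[OF refl], subst c) simp
  finally show ?thesis .
qed

lemma eval2_altdef:
  fixes F :: "'k::field poly poly"
  assumes "homogeneous2 d F"
  shows "eval2 F v = (\<Sum>j\<le>d. coeff (coeff F j) (d - j) * (v $ 1) ^ (d - j) * (v $ 2) ^ j)"
  by (simp add: eval2_def poly_homogeneous2[OF assms] poly_sum poly_monom)

lemma coprime_forms_no_common_zero:
  fixes F G :: "'k::field poly poly"
  assumes "homogeneous2 d F" "homogeneous2 d G" "coprime F G" "v \<noteq> 0"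
  shows "eval2 F v \<noteq> 0 \<or> eval2 G v \<noteq> 0"
proof (rule ccontr)
  assume neg: "\<not> ?thesis"
  show False
  proof (cases "v $ 1 = 0")
    case True
    then have y: "v $ 2 \<noteq> 0" using assms(4) by (auto simp: vec_eq_iff forall_2)
    have "[:[:0, 1:]:] dvd H" if H: "homogeneous2 d H" "eval2 H v = 0" for H :: "'k poly poly"
    proof -
      have "eval2 H v = coeff (coeff H d) 0 * (v $ 2) ^ d"
        unfolding eval2_altdef[OF H(1)] using True
        by (subst sum.remove[of _ d]) (auto intro!: sum.neutral simp: power_0_left)
      with H y have "coeff (coeff H d) 0 = 0" by simp
      then have "coeff (coeff H j) 0 = 0" for j
        using H(1) unfolding homogeneous2_def by (metis add_0)
      then have "[:0, 1:] dvd coeff H j" for j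
        using poly_eq_0_iff_dvd[of "coeff H j" 0] by (simp add: poly_0_coeff_0)
      then show ?thesis by (simp add: const_poly_dvd_iff)
    qed
    then have "is_unit [:[:0, 1 :: 'k:]:]"
      using assms(1-3) neg coprime_common_divisor by blast
    then show False by (auto simp: is_unit_poly_iff is_unit_pCons_iff)
  next
    case False
    define r where "r = v $ 2 / v $ 1"
    have "[:- [:0, r:], 1:] dvd H" if H: "homogeneous2 d H" "eval2 H v = 0" for H :: "'k poly poly"
    proof -
      define c where "c = (\<Sum>j\<le>d. coeff (coeff H j) (d - j) * r ^ j)"
      have "monom a (d - j) * [:0, r:] ^ j = monom (a * r ^ j) d" if "j \<le> d" for a j
      proof -
        have "[:0, r:] = monom r 1" by (simp add: monom_altdef)
        then show ?thesis using that by (simp add: monom_power mult_monom)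
      qed
      then have "poly H [:0, r:] = monom c d"
        by (simp add: poly_homogeneous2[OF H(1)] c_def monom_sum)
      moreover have "eval2 H v = (v $ 1) ^ d * c"
        unfolding eval2_altdef[OF H(1)] c_def sum_distrib_left
      proof (rule sum.cong[OF refl])
        fix j assume "j \<in> {..d}"
        then have "(v $ 1) ^ d = (v $ 1) ^ (d - j) * (v $ 1) ^ j"
          by (simp flip: power_add)
        moreover have "(v $ 1) ^ j * r ^ j = (v $ 2) ^ j"
          using False by (simp add: r_def power_divide)
        ultimately show "coeff (coeff H j) (d - j) * v $ 1 ^ (d - j) * v $ 2 ^ j =
            v $ 1 ^ d * (coeff (coeff H j) (d - j) * r ^ j)"
          by (simp add: mult_ac)
      qed
      ultimately have "poly H [:0, r:] = 0" using H(2) False by simp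
      then show ?thesis by (simp add: poly_eq_0_iff_dvd)
    qed
    then have "is_unit [:- [:0, r:], 1:]"
      using assms(1-3) neg coprime_common_divisor by blast
    then show False by (auto simp: is_unit_poly_iff)
  qed
qed

end

theory Submission
  imports Defs
begin

text \<open>
  Every finite set of elements of an algebraic closure of the prime field of characteristic \<open>p\<close> is fixed
  by the power map \<open>a \<mapsto> a\<^sup>q\<close> for a suitable power \<open>q\<close> of \<open>p\<close>. Hence \<open>\<Gamma>\<close> lifts to a finite group \<open>G\<close>
  of matrices over the field with \<open>q\<close> elements (\<open>pgl_finite_frobenius_lift\<close>). These matrices commute
  with the coordinatewise Frobenius map \<open>v \<mapsto> v\<^sup>Q\<close>, where \<open>Q = q\<^sup>2\<close>. So if \<open>a\<close> and \<open>b\<close> are \<open>G\<close>-invariant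
  forms with \<open>deg a + 1 = deg b + Q\<close>, then \<open>F v = a(v) v + b(v) v\<^sup>Q\<close> is a \<open>G\<close>-equivariant pair of forms,
  and where it has no common zero it induces an endomorphism \<open>f\<close> of the projective line that commutes
  with \<open>\<Gamma>\<close>.

  The fixed points of such an \<open>f\<close> can be prescribed: \<open>F v\<close> is proportional to \<open>v\<close> exactly when
  \<open>b(v) = 0\<close> or \<open>v\<^sup>Q\<close> is proportional to \<open>v\<close>. Taking for \<open>b\<close> a power of the product of the linear forms
  \<open>v \<mapsto> det (t, M v)\<close> over \<open>M \<in> G\<close>, the fixed point set becomes \<open>T \<union> \<Gamma>t\<close>, where \<open>T\<close> is the projective
  line over the field with \<open>Q\<close> elements. A power of \<open>X\<^sup>q Y - X Y\<^sup>q\<close>, scaled by a suitable constant, provides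
  an \<open>a\<close> of the right degree without introducing common zeros
  (\<open>exists_equivariant_endo_with_fixed_points\<close>).

  An automorphism of \<open>f\<close> permutes \<open>T \<union> \<Gamma>t\<close>. Once \<open>T\<close> has at least \<open>card \<Gamma> + 3\<close> points, such a
  permutation sends at least three points of \<open>T\<close> into \<open>T\<close>, which leaves finitely many candidates, the same
  for all \<open>t\<close>; and a generic \<open>t\<close> excludes all those outside \<open>\<Gamma>\<close> (\<open>generic_orbit_rigidifies\<close>).
  Therefore the automorphism group of \<open>f\<close> is \<open>\<Gamma>\<close>.
\<close>

section \<open>Frobenius powers in an algebraic closure of a prime field\<close>

lemma power_card_UNIV_eq_self:
  fixes x :: "'a::field"
  assumes fin: "finite (UNIV :: 'a set)"
  shows "x ^ CARD('a) = x"
proof (cases "x = 0")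
  case False
  have "(\<Prod>y\<in>UNIV-{0}. x * y) = \<Prod>(UNIV-{0})"
    by (rule prod.reindex_bij_witness[of _ "\<lambda>y. y / x" "\<lambda>y. x * y"]) (use False in auto)
  moreover have "(\<Prod>y\<in>UNIV-{0}. x * y) = x ^ (CARD('a) - 1) * \<Prod>(UNIV-{0})"
    using fin by (simp add: prod.distrib)
  moreover have "\<Prod>(UNIV-{0::'a}) \<noteq> 0" using fin by simp
  ultimately have "x ^ (CARD('a) - 1) = 1" by simp
  then have "x ^ Suc (CARD('a) - 1) = x" by simp
  moreover have "CARD('a) > 0" using fin by (simp add: card_gt_0_iff)
  ultimately show ?thesis by simp
qed (use fin in \<open>simp add: card_gt_0_iff\<close>)

lemma CHAR_eq_CARD:
  assumes "prime CARD('a::field)"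
  shows "CHAR('a) = CARD('a)"
proof -
  have fin: "finite (UNIV :: 'a set)" using assms by (metis card.infinite not_prime_0)
  have "(\<Sum>x\<in>UNIV. x + 1) = (\<Sum>x\<in>UNIV. x :: 'a)"
    by (rule sum.reindex_bij_witness[of _ "\<lambda>x. x - 1" "\<lambda>x. x + 1"]) auto
  then have "of_nat CARD('a) = (0 :: 'a)" by (simp add: sum.distrib)
  then have "CHAR('a) dvd CARD('a)" by (simp add: of_nat_eq_0_iff_char_dvd)
  then show ?thesis using assms by (metis CHAR_not_1' One_nat_def prime_nat_iff)
qed

lemma inj_frobenius_power:
  fixes x y :: "'k::field"
  assumes p: "prime CHAR('k)" and eq: "x ^ (CHAR('k) ^ k) = y ^ (CHAR('k) ^ k)"
  shows "x = y"
proof -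
  have "((x - y) + y) ^ (CHAR('k) ^ k) = (x - y) ^ (CHAR('k) ^ k) + y ^ (CHAR('k) ^ k)"
    by (rule freshmans_dream'[OF p refl])
  with eq have "(x - y) ^ (CHAR('k) ^ k) = 0" by simp
  then show ?thesis by simp
qed

text \<open>
  The conjugates \<open>a\<close>, \<open>a\<^sup>p\<close>, \<open>a\<^bsup>p\<^sup>2\<^esup>\<close>, ... are all roots of one polynomial over the prime
  field, because the Frobenius map fixes its coefficients. Hence two of them coincide, and injectivity
  of the Frobenius map carries the coincidence back to \<open>a\<close>.
\<close>

lemma frobenius_periodic_alg_closure:
  fixes a :: "'f::field alg_closure"
  assumes p: "prime CARD('f)"
  shows "\<exists>k>0. a ^ (CARD('f) ^ k) = a"
proof -
  define p where "p = CARD('f)"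
  have char: "CHAR('f alg_closure) = p" using CHAR_eq_CARD[OF assms] by (simp add: p_def)
  have prime: "prime CHAR('f alg_closure)" using assms char p_def by simp
  have fin: "finite (UNIV :: 'f set)" using p by (metis card.infinite not_prime_0)
  obtain P :: "'f poly" where P: "P \<noteq> 0" "poly (map_poly to_ac P) a = 0"
    by (rule alg_closure_algebraic)
  define R where "R = {x. poly (map_poly to_ac P) x = 0}"
  have "map_poly to_ac P \<noteq> 0" using P(1) by (simp add: map_poly_eq_0_iff)
  then have finR: "finite R" unfolding R_def by (rule poly_roots_finite)
  have pw: "poly (map_poly to_ac P) (x ^ p) = (poly (map_poly to_ac P) x) ^ p" for x
  proof -
    have c: "(to_ac c) ^ p = to_ac c" for c :: 'f
      using power_card_UNIV_eq_self[OF fin, of c] by (simp add: p_def flip: to_ac_power)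
    show ?thesis
      unfolding poly_altdef freshmans_dream_sum[OF prime char[symmetric]]
      by (rule sum.cong)
         (auto simp: coeff_map_poly power_mult_distrib c mult.commute simp flip: power_mult)
  qed
  have "p > 0" using p p_def prime_gt_0_nat by simp
  have iter: "a ^ (p ^ i) \<in> R" for i
  proof (induction i)
    case (Suc i)
    then show ?case using pw[of "a ^ (p ^ i)"] \<open>p > 0\<close>
      by (simp add: R_def mult.commute flip: power_mult)
  qed (use P in \<open>simp add: R_def\<close>)
  then have "range (\<lambda>i. a ^ (p ^ i)) \<subseteq> R" by auto
  then have "\<not> inj (\<lambda>i. a ^ (p ^ i))"
    using finR finite_imageD[of "\<lambda>i. a ^ (p ^ i)" UNIV] finite_subset by auto
  then obtain i j where ij: "i < j" "a ^ (p ^ i) = a ^ (p ^ j)"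
    unfolding inj_def by (metis linorder_neqE_nat)
  then have "j = (j - i) + i" by simp
  then have "a ^ (p ^ j) = (a ^ (p ^ (j - i))) ^ (p ^ i)"
    by (metis power_add power_mult)
  with ij have "a = a ^ (p ^ (j - i))"
    using inj_frobenius_power[OF prime, of a i "a ^ (p ^ (j - i))"] char by simp
  with ij show ?thesis by (intro exI[of _ "j - i"]) (simp add: p_def)
qed

text \<open>
  Multiples of a period are periods, so the product of the individual periods works.
\<close>

lemma common_frobenius_period:
  fixes E :: "'k::field set"
  assumes "finite E" "\<And>a. a \<in> E \<Longrightarrow> \<exists>k>0. a ^ (n ^ k) = a"
  shows "\<exists>k>0. \<forall>a\<in>E. a ^ (n ^ k) = a"
  using assms
proof (induction E rule: finite_induct)
  case empty
  show ?case by auto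
next
  case (insert b E)
  have iter: "a ^ (n ^ (k * m)) = a" if "a ^ (n ^ k) = a" for a :: 'k and k m
  proof (induction m)
    case (Suc m)
    have "a ^ (n ^ (k * Suc m)) = (a ^ (n ^ k)) ^ (n ^ (k * m))"
      by (simp add: power_add flip: power_mult)
    with that Suc show ?case by simp
  qed simp
  obtain k where k: "k > 0" "\<forall>a\<in>E. a ^ (n ^ k) = a" using insert by auto
  obtain l where l: "l > 0" "b ^ (n ^ l) = b" using insert by auto
  have "\<forall>a\<in>insert b E. a ^ (n ^ (k * l)) = a"
    using iter[of _ k l] iter[of b l k] k l by (auto simp: mult.commute)
  then show ?case using k l by (intro exI[of _ "k * l"]) simp
qed

text \<open>
  Over a finite field the polynomial \<open>1 + (\<Prod>a. X - a)\<close> takes only the value \<open>1\<close>.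
\<close>

lemma infinite_UNIV_alg_closed: "infinite (UNIV :: 'k::alg_closed_field set)"
proof
  assume fin: "finite (UNIV :: 'k set)"
  define P where "P = (\<Prod>a\<in>UNIV. [:- a, 1 :: 'k:])"
  have "degree P = CARD('k)" unfolding P_def by (subst degree_prod_eq_sum_degree) auto
  then have "degree (P + 1) > 0"
    using fin by (metis card_gt_0_iff degree_1 degree_add_eq_left UNIV_not_empty)
  then obtain x where "poly (P + 1) x = 0" using alg_closed_imp_poly_has_root by blast
  moreover have "poly P x = 0" unfolding P_def by (simp add: poly_prod fin prod_zero_iff)
  ultimately show False by simp
qed

section \<open>Binary forms\<close>

text \<open>
  A polynomial of positive degree in \<open>Y\<close> stays nonconstant when \<open>X\<close> is given a value outside
  the zeros of its leading coefficient; choosing a nonzero value keeps the zero away from the origin.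
  A polynomial in \<open>X\<close> alone leaves \<open>Y\<close> free, and \<open>Y = 1\<close> serves the same purpose.
\<close>

lemma exists_nonzero_zero_of_nonunit:
  fixes H :: "'k::alg_closed_field poly poly"
  assumes "\<not> is_unit H"
  shows "\<exists>v. v \<noteq> 0 \<and> eval2 H v = 0"
proof (cases "degree H = 0")
  case True
  then obtain h where h: "H = [:h:]" by (auto elim: degree_eq_zeroE)
  have "\<exists>x. poly h x = 0"
  proof (cases "degree h = 0")
    case True
    then obtain c where "h = [:c:]" by (auto elim: degree_eq_zeroE)
    with h assms show ?thesis by (auto simp: is_unit_const_poly_iff is_unit_pCons_iff)
  next
    case False
    then show ?thesis using alg_closed_imp_poly_has_root by blast
  qed
  then obtain x where "poly h x = 0" ..
  then show ?thesis
    by (intro exI[of _ "vector [x, 1]"]) (auto simp: eval2_def h vec_eq_iff forall_2)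
next
  case False
  then have "lead_coeff H \<noteq> 0" by auto
  then have "finite {x. poly (lead_coeff H) x = 0}" by (rule poly_roots_finite)
  then have "finite (insert 0 {x. poly (lead_coeff H) x = 0})" by simp
  then obtain x where x: "x \<notin> insert 0 {x. poly (lead_coeff H) x = 0}"
    using ex_new_if_finite[OF infinite_UNIV_alg_closed] by blast
  define h where "h = map_poly (\<lambda>c. poly c x) H"
  have "coeff h (degree H) \<noteq> 0" using x by (simp add: h_def coeff_map_poly)
  then have "degree h > 0" using False le_degree by fastforce
  then obtain y where y: "poly h y = 0" using alg_closed_imp_poly_has_root by blast
  have "poly (map_poly (\<lambda>c. poly c x) G) y = poly (poly G [:y:]) x" for G
    by (induction G) (simp_all add: map_poly_pCons)
  with x y show ?thesis
    by (intro exI[of _ "vector [x, y]"]) (auto simp: eval2_def h_def vec_eq_iff forall_2)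
qed

lemma coprime_if_no_common_zero:
  fixes F G :: "'k::alg_closed_field poly poly"
  assumes "\<And>v. v \<noteq> 0 \<Longrightarrow> eval2 F v \<noteq> 0 \<or> eval2 G v \<noteq> 0"
  shows "coprime F G"
proof (rule coprimeI)
  fix H assume H: "H dvd F" "H dvd G"
  show "is_unit H"
  proof (rule ccontr)
    assume "\<not> is_unit H"
    then obtain v where v: "v \<noteq> 0" "eval2 H v = 0" using exists_nonzero_zero_of_nonunit by blast
    with H have "eval2 F v = 0" "eval2 G v = 0" by (auto simp: eval2_def dvd_def)
    with assms v show False by blast
  qed
qed

text \<open>
  Forms are handled as the functions that they induce, so that invariance and equivariance are
  plain equations between values.
\<close>

definition is_form :: "nat \<Rightarrow> ('k::field ^ 2 \<Rightarrow> 'k) \<Rightarrow> bool" where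
  "is_form d \<phi> \<longleftrightarrow> (\<exists>F. homogeneous2 d F \<and> \<phi> = eval2 F)"

lemma is_form_scale:
  assumes "is_form d \<phi>"
  shows "\<phi> (c *s v) = c ^ d * \<phi> v"
proof -
  obtain F where F: "homogeneous2 d F" "\<phi> = eval2 F" using assms by (auto simp: is_form_def)
  have "coeff (coeff F j) (d - j) * (c * v $ 1) ^ (d - j) * (c * v $ 2) ^ j =
     c ^ d * (coeff (coeff F j) (d - j) * (v $ 1) ^ (d - j) * (v $ 2) ^ j)" if "j \<le> d" for j
  proof -
    have "c ^ d = c ^ (d - j) * c ^ j" using that by (simp flip: power_add)
    then show ?thesis by (simp add: power_mult_distrib)
  qed
  then show ?thesis
    unfolding F(2) eval2_altdef[OF F(1)] sum_distrib_left by (intro sum.cong refl) auto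
qed

lemma is_form_add:
  assumes "is_form d \<phi>" "is_form d \<psi>"
  shows "is_form d (\<lambda>v. \<phi> v + \<psi> v)"
proof -
  obtain F G where "homogeneous2 d F" "\<phi> = eval2 F" "homogeneous2 d G" "\<psi> = eval2 G"
    using assms by (auto simp: is_form_def)
  then have "homogeneous2 d (F + G)" "(\<lambda>v. \<phi> v + \<psi> v) = eval2 (F + G)"
    by (auto simp: homogeneous2_def eval2_def) (metis add_0)
  then show ?thesis unfolding is_form_def by blast
qed

lemma is_form_mult:
  assumes "is_form d \<phi>" "is_form e \<psi>"
  shows "is_form (d + e) (\<lambda>v. \<phi> v * \<psi> v)"
proof -
  obtain F G where FG: "homogeneous2 d F" "\<phi> = eval2 F" "homogeneous2 e G" "\<psi> = eval2 G"
    using assms by (auto simp: is_form_def)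
  have "homogeneous2 (d + e) (F * G)" unfolding homogeneous2_def
  proof (intro allI impI)
    fix i j assume "coeff (coeff (F * G) j) i \<noteq> 0"
    then have "(\<Sum>k\<le>j. coeff (coeff F k * coeff G (j - k)) i) \<noteq> 0"
      by (simp add: coeff_mult coeff_sum)
    then obtain k where k: "k \<le> j" "coeff (coeff F k * coeff G (j - k)) i \<noteq> 0"
      by (meson atMost_iff sum.neutral)
    then have "(\<Sum>l\<le>i. coeff (coeff F k) l * coeff (coeff G (j - k)) (i - l)) \<noteq> 0"
      by (simp add: coeff_mult)
    then obtain l where l: "l \<le> i" "coeff (coeff F k) l * coeff (coeff G (j - k)) (i - l) \<noteq> 0"
      by (meson atMost_iff sum.neutral)
    with FG have "l + k = d" "(i - l) + (j - k) = e" by (auto simp: homogeneous2_def)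
    with k l show "i + j = d + e" by simp
  qed
  moreover have "(\<lambda>v. \<phi> v * \<psi> v) = eval2 (F * G)" using FG by (auto simp: eval2_def)
  ultimately show ?thesis unfolding is_form_def by blast
qed

lemma is_form_const: "is_form 0 (\<lambda>v. c)"
  unfolding is_form_def homogeneous2_def
  by (rule exI[of _ "[:[:c:]:]"]) (auto simp: eval2_def coeff_pCons split: nat.splits)

lemma is_form_nth: "is_form 1 (\<lambda>v. v $ i)"
proof -
  have "is_form 1 (\<lambda>v. v $ 1)" unfolding is_form_def homogeneous2_def
    by (rule exI[of _ "[:[:0, 1:]:]"]) (auto simp: eval2_def coeff_pCons split: nat.splits)
  moreover have "is_form 1 (\<lambda>v. v $ 2)" unfolding is_form_def homogeneous2_def
    by (rule exI[of _ "[:0, 1:]"]) (auto simp: eval2_def coeff_pCons split: nat.splits)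
  ultimately show ?thesis using exhaust_2[of i] by auto
qed

lemma is_form_cmult: "is_form d \<phi> \<Longrightarrow> is_form d (\<lambda>v. c * \<phi> v)"
  using is_form_mult[OF is_form_const] by fastforce

lemma is_form_diff:
  assumes "is_form d \<phi>" "is_form d \<psi>"
  shows "is_form d (\<lambda>v. \<phi> v - \<psi> v)"
  using is_form_add[OF assms(1) is_form_cmult[OF assms(2), of "-1"]] by simp

lemma is_form_prod:
  assumes "\<And>i. i \<in> I \<Longrightarrow> is_form d (\<phi> i)"
  shows "is_form (card I * d) (\<lambda>v. \<Prod>i\<in>I. \<phi> i v)"
  using assms
proof (induction I rule: infinite_finite_induct)
  case (insert x F)
  then have "is_form (d + card F * d) (\<lambda>v. \<phi> x v * (\<Prod>i\<in>F. \<phi> i v))"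
    by (intro is_form_mult) auto
  with insert show ?case by simp
qed (simp_all add: is_form_const)

lemma is_form_power:
  assumes "is_form d \<phi>"
  shows "is_form (n * d) (\<lambda>v. \<phi> v ^ n)"
  using is_form_prod[of "{..<n}" d "\<lambda>_. \<phi>"] assms by simp

text \<open>
  Two forms of equal degree without a common zero are coprime, and their homogeneity makes the
  induced map independent of the vector that represents a point.
\<close>

lemma proj_endo_of_forms:
  fixes \<phi> \<psi> :: "'k::alg_closed_field ^ 2 \<Rightarrow> 'k"
  assumes forms: "is_form d \<phi>" "is_form d \<psi>"
    and nz: "\<And>v. v \<noteq> 0 \<Longrightarrow> \<phi> v \<noteq> 0 \<or> \<psi> v \<noteq> 0"
  obtains f where "proj_endo d f"
    "\<And>v. v \<noteq> 0 \<Longrightarrow> f (proj_pt v) = proj_pt (vector [\<phi> v, \<psi> v])"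
proof -
  obtain F G where FG: "homogeneous2 d F" "\<phi> = eval2 F" "homogeneous2 d G" "\<psi> = eval2 G"
    using forms by (auto simp: is_form_def)
  define r where "r x = (SOME v. v \<noteq> 0 \<and> x = proj_pt v)" for x :: "'k proj_line"
  have r: "r x \<noteq> 0 \<and> x = proj_pt (r x)" for x
    unfolding r_def by (rule someI_ex) (use proj_pt_cases in metis)
  define f where "f x = (proj_pt (vector [\<phi> (r x), \<psi> (r x)]) :: 'k proj_line)" for x
  have f: "f (proj_pt v) = proj_pt (vector [\<phi> v, \<psi> v])" if v: "v \<noteq> 0" for v
  proof -
    define w where "w = r (proj_pt v)"
    have w: "w \<noteq> 0" "proj_pt v = proj_pt w" using r unfolding w_def by metis+
    then obtain c where c: "c \<noteq> 0" "w = c *s v" using v proj_pt_eq_iff by blast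
    have vw: "vector [\<phi> w, \<psi> w] = c ^ d *s (vector [\<phi> v, \<psi> v] :: 'k ^ 2)"
      by (simp add: c is_form_scale[OF forms(1)] is_form_scale[OF forms(2)] vec_eq_iff forall_2)
    have "(vector [\<phi> u, \<psi> u] :: 'k ^ 2) \<noteq> 0" if "u \<noteq> 0" for u
      using nz[OF that] by (auto simp: vec_eq_iff forall_2)
    then have "proj_pt (vector [\<phi> v, \<psi> v] :: 'k^2) = proj_pt (vector [\<phi> w, \<psi> w])"
      using v w c vw by (subst proj_pt_eq_iff) (auto intro!: exI[of _ "c ^ d"])
    then show ?thesis by (simp add: f_def w_def)
  qed
  have "coprime F G" by (rule coprime_if_no_common_zero) (use nz FG in auto)
  then have "proj_endo d f" unfolding proj_endo_def using FG f by blast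
  with f that show ?thesis by blast
qed

section \<open>Points of the projective line and the action of \<open>PGL\<^sub>2\<close>\<close>

text \<open>
  The determinant of two vectors of the plane. It tests equality of points of the projective line.
\<close>

definition wedge :: "'k::field ^ 2 \<Rightarrow> 'k ^ 2 \<Rightarrow> 'k" where
  "wedge v w = v $ 1 * w $ 2 - v $ 2 * w $ 1"

lemma wedge_self [simp]: "wedge v v = 0"
  by (simp add: wedge_def)

lemma wedge_eq_0_iff_proj_pt:
  assumes "v \<noteq> 0" "w \<noteq> 0"
  shows "wedge v w = 0 \<longleftrightarrow> proj_pt v = proj_pt w"
proof -
  have "\<exists>c. c \<noteq> 0 \<and> w = c *s v" if "wedge v w = 0"
  proof (cases "v $ 1 = 0")
    case True
    then have "v $ 2 \<noteq> 0" using assms by (auto simp: vec_eq_iff forall_2)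
    with True that assms show ?thesis
      by (intro exI[of _ "w $ 2 / v $ 2"]) (auto simp: wedge_def vec_eq_iff forall_2)
  next
    case False
    have e: "v $ 1 * w $ 2 = v $ 2 * w $ 1" using that by (simp add: wedge_def)
    have "w $ 1 \<noteq> 0" using e False assms by (auto simp: vec_eq_iff forall_2)
    with e False show ?thesis
      by (intro exI[of _ "w $ 1 / v $ 1"]) (auto simp: vec_eq_iff forall_2 field_simps)
  qed
  then show ?thesis
    unfolding proj_pt_eq_iff[OF assms] by (auto simp: wedge_def)
qed

lemma wedge_matrix:
  fixes M :: "'k::field ^ 2 ^ 2"
  shows "wedge (M *v v) (M *v w) = det M * wedge v w"
  by (simp add: wedge_def matrix_vector_mult_def det_2 UNIV_2 algebra_simps)

lemma invertible_mult_nonzero: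
  fixes A :: "'k::field ^ 2 ^ 2"
  assumes "invertible A" "v \<noteq> 0"
  shows "A *v v \<noteq> 0"
  using assms by (metis invertible_def matrix_vector_mul_assoc matrix_vector_mul_lid
        matrix_vector_mult_0_right)

definition pgl :: "'k::field ^ 2 ^ 2 \<Rightarrow> ('k ^ 2 ^ 2) set" where
  "pgl A = scalars2 #>\<^bsub>GL2\<^esub> A"

lemma pgl_act_pgl:
  assumes "invertible A" "v \<noteq> 0"
  shows "pgl_act (pgl A) (proj_pt v) = proj_pt (A *v v)"
  unfolding pgl_def by (rule pgl_act_coset[OF assms])

lemma carrier_PGL2: "carrier PGL2 = pgl ` {A. invertible A}"
  by (auto simp: PGL2_def FactGroup_def RCOSETS_def pgl_def GL2_def)

lemma pgl_mult:
  assumes "invertible A" "invertible B"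
  shows "pgl A \<otimes>\<^bsub>PGL2\<^esub> pgl B = pgl (A ** B)"
  using normal.rcos_sum[OF normal_scalars2, of A B] assms
  by (simp add: PGL2_def FactGroup_def pgl_def GL2_def)

lemma pgl_1: "pgl (mat 1) = \<one>\<^bsub>PGL2\<^esub>"
proof -
  have "pgl (mat 1) = scalars2"
    unfolding pgl_def r_coset_def GL2_def by (auto simp: scalars2_def mat_mult_mat)
  then show ?thesis by (simp add: PGL2_def FactGroup_def)
qed

lemma pgl_act_mult:
  assumes "\<alpha> \<in> carrier PGL2" "\<beta> \<in> carrier PGL2"
  shows "pgl_act (\<alpha> \<otimes>\<^bsub>PGL2\<^esub> \<beta>) x = pgl_act \<alpha> (pgl_act \<beta> x)"
proof -
  obtain A B where AB: "invertible A" "\<alpha> = pgl A" "invertible B" "\<beta> = pgl B"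
    using assms by (auto simp: carrier_PGL2)
  obtain v where v: "v \<noteq> 0" "x = proj_pt v" by (rule proj_pt_cases)
  with AB show ?thesis
    by (simp add: pgl_mult pgl_act_pgl invertible_mult invertible_mult_nonzero
        matrix_vector_mul_assoc)
qed

lemma pgl_act_one: "pgl_act \<one>\<^bsub>PGL2\<^esub> x = x"
proof -
  obtain v where v: "v \<noteq> 0" "x = proj_pt v" by (rule proj_pt_cases)
  have "invertible (mat 1 :: 'a^2^2)" by (rule invertible_mat) simp
  with v show ?thesis by (simp add: pgl_act_pgl flip: pgl_1)
qed

lemma pgl_act_inv:
  assumes "\<alpha> \<in> carrier PGL2"
  shows "pgl_act (inv\<^bsub>PGL2\<^esub> \<alpha>) (pgl_act \<alpha> x) = x"
    and "pgl_act \<alpha> (pgl_act (inv\<^bsub>PGL2\<^esub> \<alpha>) x) = x"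
proof -
  interpret group PGL2 by (rule group_PGL2)
  show "pgl_act (inv\<^bsub>PGL2\<^esub> \<alpha>) (pgl_act \<alpha> x) = x" "pgl_act \<alpha> (pgl_act (inv\<^bsub>PGL2\<^esub> \<alpha>) x) = x"
    using assms by (simp_all add: pgl_act_one flip: pgl_act_mult)
qed

lemma pgl_act_eq_iff:
  assumes "\<alpha> \<in> carrier PGL2"
  shows "pgl_act \<alpha> x = pgl_act \<alpha> y \<longleftrightarrow> x = y"
  using pgl_act_inv(1)[OF assms] by metis

lemma Aut_iff_commute:
  "\<alpha> \<in> Aut f \<longleftrightarrow> \<alpha> \<in> carrier PGL2 \<and> (\<forall>x. f (pgl_act \<alpha> x) = pgl_act \<alpha> (f x))"
proof (cases "\<alpha> \<in> carrier PGL2")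
  case True
  have "pgl_act (inv\<^bsub>PGL2\<^esub> \<alpha>) y = z \<longleftrightarrow> y = pgl_act \<alpha> z" for y z
    using pgl_act_inv[OF True] by metis
  with True show ?thesis by (simp add: Aut_def conj_endo_def fun_eq_iff)
qed (simp add: Aut_def)

text \<open>
  A matrix fixing three points has three pairwise independent eigenvectors. The determinant is the
  product of the eigenvalues of any two of them, so all three eigenvalues agree and the matrix is
  scalar.
\<close>

lemma pgl_fixing_three_points:
  fixes \<alpha> :: "('k::field ^ 2 ^ 2) set"
  assumes \<alpha>: "\<alpha> \<in> carrier PGL2"
    and fix3: "pgl_act \<alpha> x = x" "pgl_act \<alpha> y = y" "pgl_act \<alpha> z = z"
    and distinct: "x \<noteq> y" "x \<noteq> z" "y \<noteq> z"
  shows "\<alpha> = \<one>\<^bsub>PGL2\<^esub>"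
proof -
  obtain A where A: "invertible A" "\<alpha> = pgl A" using \<alpha> by (auto simp: carrier_PGL2)
  obtain u v w where pts: "u \<noteq> 0" "x = proj_pt u" "v \<noteq> 0" "y = proj_pt v" "w \<noteq> 0" "z = proj_pt w"
    by (metis proj_pt_cases)
  have eig: "\<exists>c. c \<noteq> 0 \<and> A *v s = c *s s" if "s \<noteq> 0" "pgl_act \<alpha> (proj_pt s) = proj_pt s" for s
    using that A proj_pt_eq_iff[OF that(1) invertible_mult_nonzero[OF A(1) that(1)]]
    by (simp add: pgl_act_pgl)
  obtain a b c where abc: "a \<noteq> 0" "A *v u = a *s u" "A *v v = b *s v" "A *v w = c *s w"
    using eig fix3 pts by metis
  have nz: "wedge u v \<noteq> 0" "wedge u w \<noteq> 0" "wedge v w \<noteq> 0"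
    using pts distinct by (auto simp: wedge_eq_0_iff_proj_pt)
  have scale: "wedge (s *s p) (t *s q) = s * t * wedge p q" for s t and p q :: "'k ^ 2"
    by (simp add: wedge_def algebra_simps)
  have prods: "det A = a * b" "det A = a * c" "det A = b * c"
    using wedge_matrix[of A u v] wedge_matrix[of A u w] wedge_matrix[of A v w] nz
    by (simp_all add: abc scale)
  with abc(1) have "b = c" by simp
  moreover have "det A \<noteq> 0" using A(1) invertible_det_nz by blast
  ultimately have "b = a" "c = a" using prods by auto
  have coeffs: "A$1$1 * u$1 + A$1$2 * u$2 = a * u$1" "A$2$1 * u$1 + A$2$2 * u$2 = a * u$2"
     "A$1$1 * v$1 + A$1$2 * v$2 = a * v$1" "A$2$1 * v$1 + A$2$2 * v$2 = a * v$2"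
    using abc \<open>b = a\<close> by (auto simp: vec_eq_iff forall_2 matrix_vector_mult_def UNIV_2)
  have kernel: "p * wedge u v = 0 \<and> q * wedge u v = 0"
    if "p * u$1 + q * u$2 = 0" "p * v$1 + q * v$2 = 0" for p q
  proof -
    have "p * wedge u v = (p * u$1 + q * u$2) * v$2 - (p * v$1 + q * v$2) * u$2"
      "q * wedge u v = (p * v$1 + q * v$2) * u$1 - (p * u$1 + q * u$2) * v$1"
      by (simp_all add: wedge_def algebra_simps)
    with that show ?thesis by simp
  qed
  have "(A$1$1 - a) * wedge u v = 0" "A$1$2 * wedge u v = 0"
    "A$2$1 * wedge u v = 0" "(A$2$2 - a) * wedge u v = 0"
    using kernel[of "A$1$1 - a" "A$1$2"] kernel[of "A$2$1" "A$2$2 - a"] coeffs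
    by (simp_all add: algebra_simps)
  then have "A = mat a" using nz by (auto simp: vec_eq_iff forall_2 mat_def)
  have "pgl (mat d) = scalars2" if "d \<noteq> 0" for d :: 'k
  proof
    show "scalars2 \<subseteq> pgl (mat d)"
    proof
      fix S :: "'k^2^2" assume "S \<in> scalars2"
      then obtain e where "S = mat e" "e \<noteq> 0" by (auto simp: scalars2_def)
      with that have "S = mat (e / d) ** mat d" "mat (e / d) \<in> (scalars2 :: ('k^2^2) set)"
        by (auto simp: mat_mult_mat scalars2_def)
      then show "S \<in> pgl (mat d)" unfolding pgl_def r_coset_def GL2_def by auto
    qed
  qed (use that in \<open>auto simp: pgl_def r_coset_def GL2_def scalars2_def mat_mult_mat\<close>)
  from this[OF abc(1)] this[of 1] have "pgl A = pgl (mat 1)" by (simp add: \<open>A = mat a\<close>)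
  with A show ?thesis by (simp add: pgl_1)
qed

lemma pgl_determined_by_three_points:
  assumes \<alpha>: "\<alpha> \<in> carrier PGL2" and \<beta>: "\<beta> \<in> carrier PGL2"
    and three: "card S \<ge> 3" "\<And>x. x \<in> S \<Longrightarrow> pgl_act \<alpha> x = pgl_act \<beta> x"
  shows "\<alpha> = \<beta>"
proof -
  interpret group PGL2 by (rule group_PGL2)
  obtain R where "R \<subseteq> S" "card R = 3" using obtain_subset_with_card_n[OF three(1)] by metis
  then obtain x y z where xyz: "x \<in> S" "y \<in> S" "z \<in> S" "x \<noteq> y" "x \<noteq> z" "y \<noteq> z"
    by (auto simp: card_3_iff)
  define \<gamma> where "\<gamma> = inv\<^bsub>PGL2\<^esub> \<beta> \<otimes>\<^bsub>PGL2\<^esub> \<alpha>"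
  have "\<gamma> \<in> carrier PGL2" using \<alpha> \<beta> by (simp add: \<gamma>_def)
  moreover have "pgl_act \<gamma> s = s" if "s \<in> S" for s
    using three(2)[OF that] \<alpha> \<beta> by (simp add: \<gamma>_def pgl_act_mult pgl_act_inv)
  ultimately have "\<gamma> = \<one>\<^bsub>PGL2\<^esub>" using pgl_fixing_three_points xyz by metis
  then have "\<beta> \<otimes>\<^bsub>PGL2\<^esub> (inv\<^bsub>PGL2\<^esub> \<beta> \<otimes>\<^bsub>PGL2\<^esub> \<alpha>) = \<beta>" using \<beta> by (simp add: \<gamma>_def)
  then show ?thesis using \<alpha> \<beta> by (simp flip: m_assoc)
qed

section \<open>Stabilizers of finite sets with a generic orbit\<close>

text \<open>
  Suppose \<open>\<alpha>\<close> maps \<open>T \<union> \<Gamma>t\<close> into itself. At most \<open>card \<Gamma>\<close> points of \<open>T\<close> can go to \<open>\<Gamma>t\<close>, so at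
  least three go to points of \<open>T\<close>. Three points and their images determine \<open>\<alpha>\<close>; hence \<open>\<alpha>\<close> lies in
  a finite set \<open>C\<close> that depends on \<open>T\<close> but not on \<open>t\<close>. For an element of \<open>C\<close> outside \<open>\<Gamma>\<close>, only finitely
  many \<open>t\<close> are mapped into \<open>T \<union> \<Gamma>t\<close>, and these form the exceptional set \<open>E\<close>.
\<close>

lemma generic_orbit_rigidifies:
  assumes \<Gamma>: "subgroup \<Gamma> PGL2" "finite \<Gamma>"
    and T: "finite T" "card T \<ge> card \<Gamma> + 3"
  obtains E where "finite E"
    "\<And>t \<alpha>. t \<notin> E \<Longrightarrow> \<alpha> \<in> carrier PGL2 \<Longrightarrow>
      pgl_act \<alpha> ` (T \<union> (\<lambda>\<gamma>. pgl_act \<gamma> t) ` \<Gamma>) \<subseteq> T \<union> (\<lambda>\<gamma>. pgl_act \<gamma> t) ` \<Gamma> \<Longrightarrow> \<alpha> \<in> \<Gamma>"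
proof -
  have sub: "\<Gamma> \<subseteq> carrier PGL2" using \<Gamma>(1) by (rule subgroup.subset)
  \<comment> \<open>The graph of the partial map that \<open>\<alpha>\<close> induces on \<open>T\<close>. It is a subset of the finite set
    \<open>T \<times> T\<close> and, by the three points, determines each \<open>\<alpha> \<in> C\<close>.\<close>
  define g where "g \<alpha> = {(x, pgl_act \<alpha> x) | x. x \<in> T \<and> pgl_act \<alpha> x \<in> T}" for \<alpha>
  define C where "C = {\<alpha> \<in> carrier PGL2. card {x \<in> T. pgl_act \<alpha> x \<in> T} \<ge> 3}"
  have "inj_on g C"
  proof (rule inj_onI)
    fix \<alpha> \<beta> assume *: "\<alpha> \<in> C" "\<beta> \<in> C" "g \<alpha> = g \<beta>"
    have "pgl_act \<alpha> x = pgl_act \<beta> x" if "x \<in> {x \<in> T. pgl_act \<alpha> x \<in> T}" for x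
    proof -
      have "(x, pgl_act \<alpha> x) \<in> g \<alpha>" using that by (auto simp: g_def)
      then show ?thesis using *(3) by (auto simp: g_def)
    qed
    then show "\<alpha> = \<beta>"
      using * by (intro pgl_determined_by_three_points[where S = "{x \<in> T. pgl_act \<alpha> x \<in> T}"])
        (auto simp: C_def)
  qed
  moreover have "g ` C \<subseteq> Pow (T \<times> T)" by (auto simp: g_def)
  ultimately have finC: "finite C"
    using T(1) by (meson finite_Pow_iff finite_SigmaI finite_imageD finite_subset)
  have finT: "finite {t. pgl_act \<alpha> t \<in> T}" if "\<alpha> \<in> C" for \<alpha>
  proof -
    have "{t. pgl_act \<alpha> t \<in> T} \<subseteq> pgl_act (inv\<^bsub>PGL2\<^esub> \<alpha>) ` T"
    proof
      fix t assume "t \<in> {t. pgl_act \<alpha> t \<in> T}"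
      then show "t \<in> pgl_act (inv\<^bsub>PGL2\<^esub> \<alpha>) ` T"
        using that pgl_act_inv(1)[of \<alpha> t]
        by (intro image_eqI[of _ _ "pgl_act \<alpha> t"]) (auto simp: C_def)
    qed
    then show ?thesis using T(1) finite_surj by blast
  qed
  have finE: "finite {t. pgl_act \<alpha> t = pgl_act \<gamma> t}" if "\<alpha> \<in> C" "\<gamma> \<in> \<Gamma>" "\<alpha> \<noteq> \<gamma>" for \<alpha> \<gamma>
  proof (rule ccontr)
    assume "infinite {t. pgl_act \<alpha> t = pgl_act \<gamma> t}"
    then obtain S where "card S = 3" "S \<subseteq> {t. pgl_act \<alpha> t = pgl_act \<gamma> t}"
      using infinite_arbitrarily_large by metis
    then have "\<alpha> = \<gamma>" using that sub
      by (intro pgl_determined_by_three_points[of \<alpha> \<gamma> S]) (auto simp: C_def)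
    with that show False by simp
  qed
  define E where "E = (\<Union>\<alpha>\<in>C - \<Gamma>.
      {t. pgl_act \<alpha> t \<in> T} \<union> (\<Union>\<gamma>\<in>\<Gamma>. {t. pgl_act \<alpha> t = pgl_act \<gamma> t}))"
  have "finite E" unfolding E_def using finC finT finE \<Gamma>(2) by (intro finite_UN_I finite_UnI) auto
  moreover have "\<alpha> \<in> \<Gamma>" if t: "t \<notin> E" and \<alpha>: "\<alpha> \<in> carrier PGL2"
    and stab: "pgl_act \<alpha> ` (T \<union> (\<lambda>\<gamma>. pgl_act \<gamma> t) ` \<Gamma>) \<subseteq> T \<union> (\<lambda>\<gamma>. pgl_act \<gamma> t) ` \<Gamma>" for t \<alpha>
  proof (rule ccontr)
    assume no: "\<alpha> \<notin> \<Gamma>"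
    define O' where "O' = (\<lambda>\<gamma>. pgl_act \<gamma> t) ` \<Gamma>"
    define S where "S = {x \<in> T. pgl_act \<alpha> x \<in> T}"
    have "pgl_act \<alpha> ` (T - S) \<subseteq> O'" using stab by (auto simp: S_def O'_def)
    moreover have "inj_on (pgl_act \<alpha>) (T - S)" using \<alpha> by (auto simp: inj_on_def pgl_act_eq_iff)
    ultimately have "card (T - S) \<le> card O'"
      using \<Gamma>(2) O'_def by (metis card_inj_on_le finite_imageI)
    also have "\<dots> \<le> card \<Gamma>" unfolding O'_def by (rule card_image_le[OF \<Gamma>(2)])
    finally have "card S \<ge> 3"
      using T card_Diff_subset[of S T] card_mono[of T S] by (auto simp: S_def)
    then have "\<alpha> \<in> C" using \<alpha> by (simp add: C_def S_def)
    have "t \<in> O'" unfolding O'_def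
      by (rule image_eqI[of _ _ "\<one>\<^bsub>PGL2\<^esub>"]) (auto simp: pgl_act_one subgroup.one_closed[OF \<Gamma>(1)])
    then have "pgl_act \<alpha> t \<in> T \<union> O'" using stab by (auto simp: O'_def)
    with \<open>\<alpha> \<in> C\<close> no have "t \<in> E" by (auto simp: E_def O'_def)
    with t show False by contradiction
  qed
  ultimately show ?thesis using that by blast
qed

section \<open>Fixed vectors of Frobenius\<close>

definition frob :: "nat \<Rightarrow> 'k::field ^ 2 \<Rightarrow> 'k ^ 2" where
  "frob n v = (\<chi> i. v $ i ^ n)"

text \<open>
  This is \<open>X\<^sup>n Y - X Y\<^sup>n\<close>. For \<open>n = q\<close> a power of the characteristic its zeros are exactly the
  points defined over the field with \<open>q\<close> elements, and it is the basic Dickson semi-invariant of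
  the general linear group over that field.
\<close>

definition rational_form :: "nat \<Rightarrow> 'k::field ^ 2 \<Rightarrow> 'k" where
  "rational_form n v = wedge (frob n v) v"

lemma is_form_rational_form: "is_form (n + 1) (rational_form n)"
proof -
  have "is_form (n * 1 + 1) (\<lambda>v. v $ 1 ^ n * v $ 2 - v $ 2 ^ n * v $ 1)"
    by (intro is_form_diff is_form_mult is_form_power is_form_nth)
  then show ?thesis by (simp add: rational_form_def[abs_def] wedge_def frob_def)
qed

lemma rational_form_scale: "rational_form n (c *s v) = c ^ (n + 1) * rational_form n v"
  by (rule is_form_scale[OF is_form_rational_form])

lemma rational_form_eq_0_iff:
  assumes "n > 0"
  shows "rational_form n v = 0 \<longleftrightarrow> (\<exists>c u. frob n u = u \<and> u \<noteq> 0 \<and> v = c *s u)"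
proof
  assume "\<exists>c u. frob n u = u \<and> u \<noteq> 0 \<and> v = c *s u"
  then obtain c u where u: "frob n u = u" "v = c *s u" by blast
  then have "rational_form n u = 0" by (simp add: rational_form_def)
  with u show "rational_form n v = 0" by (simp add: rational_form_scale)
next
  assume zero: "rational_form n v = 0"
  show "\<exists>c u. frob n u = u \<and> u \<noteq> 0 \<and> v = c *s u"
  proof (cases "v $ 2 = 0")
    case True
    then show ?thesis using assms
      by (intro exI[of _ "v $ 1"] exI[of _ "vector [1, 0]"])
         (auto simp: frob_def vec_eq_iff forall_2)
  next
    case False
    have "v $ 1 ^ n * v $ 2 = v $ 2 ^ n * v $ 1"
      using zero by (simp add: rational_form_def wedge_def frob_def)
    then have "(v $ 1 / v $ 2) ^ n = v $ 1 / v $ 2"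
      using False by (simp add: power_divide field_simps)
    with False show ?thesis
      by (intro exI[of _ "v $ 2"] exI[of _ "vector [v $ 1 / v $ 2, 1]"])
         (auto simp: frob_def vec_eq_iff forall_2)
  qed
qed

lemma frob_square_fixed:
  assumes "frob n u = u"
  shows "frob (n ^ 2) u = u"
proof -
  have "frob (n ^ 2) u = frob n (frob n u)"
    unfolding frob_def power2_eq_square power_mult by simp
  with assms show ?thesis by simp
qed

lemma finite_vec2:
  assumes "finite S"
  shows "finite {v :: 'a ^ 2. \<forall>i. v $ i \<in> S}"
proof (rule finite_subset)
  show "{v :: 'a ^ 2. \<forall>i. v $ i \<in> S} \<subseteq> (\<lambda>(a, b). \<chi> i. if i = 1 then a else b) ` (S \<times> S)"
  proof
    fix v :: "'a ^ 2" assume "v \<in> {v. \<forall>i. v $ i \<in> S}"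
    then show "v \<in> (\<lambda>(a, b). \<chi> i. if i = 1 then a else b) ` (S \<times> S)"
      by (intro image_eqI[of _ _ "(v $ 1, v $ 2)"]) (auto simp: vec_eq_iff forall_2)
  qed
qed (use assms in simp)

lemma finite_power_fixed:
  assumes "n \<ge> 2"
  shows "finite {a :: 'k::field. a ^ n = a}"
proof -
  have "coeff [:0, 1 :: 'k:] n = 0" using assms by (intro coeff_eq_0) simp
  then have "coeff (monom 1 n - [:0, 1 :: 'k:]) n \<noteq> 0" by simp
  then have "monom 1 n - [:0, 1 :: 'k:] \<noteq> 0" by (metis coeff_0)
  then have "finite {a. poly (monom 1 n - [:0, 1 :: 'k:]) a = 0}" by (rule poly_roots_finite)
  then show ?thesis by (simp add: poly_monom)
qed

lemma finite_frob_fixed: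
  assumes "n \<ge> 2"
  shows "finite {u :: 'k::field ^ 2. frob n u = u}"
  using finite_vec2[OF finite_power_fixed[OF assms]] by (simp add: frob_def vec_eq_iff)

section \<open>Equivariant maps of finite matrix groups over a finite field\<close>

text \<open>
  The elements of \<open>G\<close> are invertible matrices over the field with \<open>q\<close> elements, which is described as
  the set of fixed points of the \<open>q\<close>-th power map. Their crucial property is that they commute with
  this map acting on coordinates. A nonempty finite set of invertible matrices that is closed under
  multiplication contains the inverses of its elements, so \<open>G\<close> is a group unless it is empty.
\<close>

locale finite_frobenius_group =
  fixes k q :: nat and G :: "('k::alg_closed_field ^ 2 ^ 2) set"
  assumes prime_CHAR: "prime CHAR('k)" and k_pos: "k > 0" and q_def: "q = CHAR('k) ^ k"
    and finite_G: "finite G"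
    and G_invertible: "\<And>M. M \<in> G \<Longrightarrow> invertible M"
    and G_fixed: "\<And>M i j. M \<in> G \<Longrightarrow> M $ i $ j ^ q = M $ i $ j"
    and G_mult: "\<And>M N. M \<in> G \<Longrightarrow> N \<in> G \<Longrightarrow> M ** N \<in> G"
begin

lemma q_ge_2: "q \<ge> 2"
proof -
  have "2 \<le> CHAR('k)" using prime_CHAR by (rule prime_ge_2_nat)
  also have "CHAR('k) \<le> q" unfolding q_def using k_pos \<open>2 \<le> CHAR('k)\<close> by (intro self_le_power) auto
  finally show ?thesis .
qed

lemma frob_mult:
  assumes M: "M \<in> G" and n: "n = q ^ m"
  shows "frob n (M *v v) = M *v frob n v"
proof -
  have n': "n = CHAR('k) ^ (k * m)" by (simp add: n q_def power_mult)
  have fixed: "M $ i $ j ^ n = M $ i $ j" for i j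
    unfolding n by (induction m) (simp_all add: power_mult mult.commute[of q] G_fixed[OF M])
  show ?thesis
    by (simp add: frob_def vec_eq_iff matrix_vector_mult_def UNIV_2
        freshmans_dream'[OF prime_CHAR n'] power_mult_distrib fixed)
qed

lemma rational_form_mult:
  assumes "M \<in> G" "n = q ^ m"
  shows "rational_form n (M *v v) = det M * rational_form n v"
  by (simp add: rational_form_def frob_mult[OF assms] wedge_matrix)

lemma det_power:
  assumes "M \<in> G"
  shows "det M ^ (q - 1) = 1"
proof -
  have diff: "(x - y) ^ q = x ^ q - y ^ q" for x y :: 'k
    using freshmans_dream'[OF prime_CHAR q_def, of "x - y" y] by simp
  have "det M ^ q = det M" by (simp add: det_2 diff power_mult_distrib G_fixed[OF assms])
  moreover have "det M ^ q = det M * det M ^ (q - 1)"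
    using q_ge_2 by (simp flip: power_Suc)
  moreover have "det M \<noteq> 0" using G_invertible[OF assms] invertible_det_nz by blast
  ultimately show ?thesis by simp
qed

definition orbit_form :: "'k ^ 2 \<Rightarrow> 'k ^ 2 \<Rightarrow> 'k" where
  "orbit_form t v = (\<Prod>M\<in>G. wedge t (M *v v))"

lemma is_form_orbit_form: "is_form (card G) (orbit_form t)"
proof -
  have "is_form 1 (\<lambda>v. wedge t (M *v v))" for M
  proof -
    have "is_form 1 (\<lambda>v. (t $ 1 * M $ 2 $ 1 - t $ 2 * M $ 1 $ 1) * v $ 1
        + (t $ 1 * M $ 2 $ 2 - t $ 2 * M $ 1 $ 2) * v $ 2)"
      by (intro is_form_add is_form_cmult is_form_nth)
    then show ?thesis
      by (simp add: wedge_def matrix_vector_mult_def UNIV_2 algebra_simps)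
  qed
  then have "is_form (card G * 1) (\<lambda>v. \<Prod>M\<in>G. wedge t (M *v v))"
    by (intro is_form_prod) auto
  then show ?thesis by (simp add: orbit_form_def[abs_def])
qed

text \<open>
  Substituting \<open>N v\<close> only permutes the factors, since right multiplication by \<open>N\<close> is a bijection of \<open>G\<close>.
\<close>

lemma orbit_form_invariant:
  assumes N: "N \<in> G"
  shows "orbit_form t (N *v v) = orbit_form t v"
proof -
  obtain N' where N': "N ** N' = mat 1" using G_invertible[OF N] by (auto simp: invertible_def)
  have "inj_on (\<lambda>M. M ** N) G"
    by (rule inj_on_inverseI[of _ "\<lambda>M. M ** N'"]) (simp add: N' flip: matrix_mul_assoc)
  moreover have "(\<lambda>M. M ** N) ` G \<subseteq> G" using G_mult N by auto
  ultimately have "bij_betw (\<lambda>M. M ** N) G G"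
    using finite_G by (simp add: bij_betw_def endo_inj_surj)
  then have "(\<Prod>M\<in>G. wedge t ((M ** N) *v v)) = (\<Prod>M\<in>G. wedge t (M *v v))"
    by (rule prod.reindex_bij_betw)
  then show ?thesis by (simp add: orbit_form_def matrix_vector_mul_assoc)
qed

lemma orbit_form_eq_0_iff: "orbit_form t v = 0 \<longleftrightarrow> (\<exists>M\<in>G. wedge t (M *v v) = 0)"
  using finite_G by (simp add: orbit_form_def)

text \<open>
  With \<open>Q = q\<^sup>2\<close>, consider \<open>F v = c A(v) v + b(v) v\<^sup>Q\<close>, where \<open>v\<^sup>Q\<close> is the coordinatewise power and
  \<open>A\<close>, \<open>b\<close> are \<open>G\<close>-invariant forms. It is equivariant because \<open>v\<close> and \<open>v\<^sup>Q\<close> are. Since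
  \<open>F v \<and> v = b(v) (v\<^sup>Q \<and> v)\<close>, the fixed points of the induced map are the zeros of \<open>b\<close> together with the
  points over the field with \<open>Q\<close> elements; \<open>b\<close> is a power of the orbit form of \<open>t\<close>, so its zeros
  form the orbit of \<open>t\<close>.
  
  The two terms have the same degree when \<open>deg A + 1 = deg b + Q\<close>. The form \<open>X\<^sup>q Y - X Y\<^sup>q\<close> has degree
  \<open>q + 1\<close> and is multiplied by \<open>det M\<close> under \<open>M\<close>, so its power with exponent \<open>q - 1\<close> is invariant of
  degree \<open>Q - 1\<close>. This is the reason to use the Frobenius map of exponent \<open>q\<^sup>2\<close> instead of \<open>q\<close>. The
  powers \<open>N + 1\<close> and \<open>Q - 1\<close>, for \<open>N\<close> the order of \<open>G\<close>, then balance the degrees.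
  
  It remains to exclude zeros of \<open>F\<close>. If \<open>v\<close> and \<open>v\<^sup>Q\<close> are independent, a zero needs \<open>A(v) = 0\<close>, which
  makes \<open>v\<close> proportional to a vector over the field with \<open>q\<close> elements and contradicts independence.
  Otherwise \<open>v\<close> is proportional to one of finitely many vectors \<open>u\<close> with \<open>u\<^sup>Q = u\<close>, where
  \<open>F u = (c A(u) + b(u)) u\<close> and \<open>b(u) \<noteq> 0\<close>; the constant \<open>c\<close> is chosen to avoid these finitely many
  zeros.
\<close>

lemma exists_equivariant_endo_with_fixed_points:
  assumes t: "rational_form (q ^ 2) t \<noteq> 0"
  obtains d f where "2 \<le> d" "proj_endo d f"
    "\<And>M x. M \<in> G \<Longrightarrow> f (pgl_act (pgl M) x) = pgl_act (pgl M) (f x)"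
    "\<And>v. v \<noteq> 0 \<Longrightarrow> f (proj_pt v) = proj_pt v \<longleftrightarrow>
       rational_form (q ^ 2) v = 0 \<or> (\<exists>M\<in>G. wedge t (M *v v) = 0)"
proof -
  define N Q where "N = card G" and "Q = q ^ 2"
  have "2 \<le> q" by (rule q_ge_2)
  then have "2 * 2 \<le> q * q" by (intro mult_le_mono)
  then have Q: "Q \<ge> 2" by (simp add: Q_def power2_eq_square)
  define A where "A v = rational_form q v ^ ((q - 1) * (N + 1))" for v :: "'k ^ 2"
  define b where "b v = orbit_form t v ^ (Q - 1)" for v
  define U where "U = {u :: 'k ^ 2. frob Q u = u \<and> u \<noteq> 0}"
  have finU: "finite U" unfolding U_def by (rule finite_subset[OF _ finite_frob_fixed[OF Q]]) auto
  have bU: "b u \<noteq> 0" if "u \<in> U" for u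
  proof
    \<comment> \<open>Otherwise \<open>t\<close> would be proportional to \<open>M u\<close>, a vector fixed by Frobenius.\<close>
    assume "b u = 0"
    then obtain M where M: "M \<in> G" "wedge t (M *v u) = 0"
      by (auto simp: b_def orbit_form_eq_0_iff)
    have "M *v u \<noteq> 0" using invertible_mult_nonzero[OF G_invertible] M that by (auto simp: U_def)
    moreover have t0: "t \<noteq> 0" using t by (auto simp: rational_form_def wedge_def)
    ultimately obtain c where "c \<noteq> 0" "M *v u = c *s t"
      using M(2) wedge_eq_0_iff_proj_pt proj_pt_eq_iff by metis
    then have "rational_form Q t = 0 \<longleftrightarrow> rational_form Q (M *v u) = 0"
      by (simp add: rational_form_scale)
    also have "rational_form Q (M *v u) = 0"
      using that rational_form_mult[OF M(1) Q_def] by (simp add: U_def rational_form_def)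
    finally show False using t by (simp add: Q_def)
  qed
  have "finite (insert 0 ((\<lambda>u. - b u / A u) ` U))" using finU by simp
  then obtain c where "c \<notin> insert 0 ((\<lambda>u. - b u / A u) ` U)"
    using ex_new_if_finite[OF infinite_UNIV_alg_closed] by blast
  then have c: "c \<noteq> 0" "\<And>u. u \<in> U \<Longrightarrow> c \<noteq> - b u / A u" by auto
  have cU: "c * A u + b u \<noteq> 0" if u: "u \<in> U" for u
  proof (cases "A u = 0")
    case False
    then show ?thesis using c(2)[OF u] by (auto simp: field_simps eq_neg_iff_add_eq_0)
  qed (use bU[OF u] in simp)
  define F where "F v = (c * A v) *s v + b v *s frob Q v" for v
  define d where "d = N * (Q - 1) + Q"
  have d: "2 \<le> d" using Q by (simp add: d_def)
  have form: "is_form d (\<lambda>v. F v $ i)" for i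
  proof -
    have "is_form (0 + (q - 1) * (N + 1) * (q + 1) + 1) (\<lambda>v. c * A v * v $ i)"
      unfolding A_def
      by (intro is_form_mult is_form_const is_form_power is_form_rational_form is_form_nth)
    moreover have "0 + (q - 1) * (N + 1) * (q + 1) + 1 = d"
    proof -
      obtain r where "q = Suc r" using \<open>2 \<le> q\<close> by (cases q) auto
      then show ?thesis by (simp add: d_def Q_def power2_eq_square algebra_simps)
    qed
    moreover have "is_form ((Q - 1) * N + Q * 1) (\<lambda>v. b v * v $ i ^ Q)"
      unfolding b_def N_def
      by (intro is_form_mult is_form_power is_form_orbit_form is_form_nth)
    ultimately show ?thesis
      using is_form_add[of d "\<lambda>v. c * A v * v $ i" "\<lambda>v. b v * v $ i ^ Q"]
      by (simp add: F_def frob_def d_def mult.commute)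
  qed
  have wedge_F: "wedge (F v) v = b v * rational_form Q v" for v
    by (simp add: F_def wedge_def rational_form_def algebra_simps)
  have F_nz: "F v \<noteq> 0" if v: "v \<noteq> 0" for v
  proof
    assume F0: "F v = 0"
    show False
    proof (cases "rational_form Q v = 0")
      case True
      then obtain e u where u: "u \<in> U" "v = e *s u"
        using rational_form_eq_0_iff[of Q v] Q by (auto simp: U_def)
      with v have "e \<noteq> 0" by auto
      have "F u $ i = 0" for i
        using is_form_scale[OF form[of i], of e u] F0 u \<open>e \<noteq> 0\<close> by simp
      then have "F u = 0" by (simp add: vec_eq_iff)
      moreover have "F u = (c * A u + b u) *s u"
        using u by (simp add: F_def U_def vec.scale_left_distrib)
      ultimately have "(c * A u + b u) *s u = 0" by simp
      then have "c * A u + b u = 0 \<or> u = 0" unfolding vector_mul_eq_0 .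
      with cU[OF u(1)] u(1) show False by (simp add: U_def)
    next
      case False
      with F0 wedge_F[of v] have "b v = 0" by (simp add: wedge_def)
      with F0 v c(1) have "A v = 0" by (simp add: F_def)
      then have "rational_form q v = 0" by (simp add: A_def)
      then obtain e u where "frob q u = u" "u \<noteq> 0" "v = e *s u"
        using rational_form_eq_0_iff[of q v] \<open>2 \<le> q\<close> by auto
      moreover have "frob Q u = u"
        unfolding Q_def by (rule frob_square_fixed) fact
      ultimately have "rational_form Q v = 0" using rational_form_eq_0_iff[of Q v] Q by auto
      with False show False by simp
    qed
  qed
  have F_equivariant: "F (M *v v) = M *v F v" if M: "M \<in> G" for M v
  proof -
    have "det M ^ ((q - 1) * (N + 1)) = 1"
      by (simp only: power_mult det_power[OF M] power_one)
    moreover have "rational_form q (M *v v) = det M * rational_form q v"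
      using M by (rule rational_form_mult[of _ _ 1]) simp
    ultimately have "A (M *v v) = A v"
      by (simp only: A_def power_mult_distrib mult_1)
    moreover have "b (M *v v) = b v" by (simp add: b_def orbit_form_invariant[OF M])
    ultimately show ?thesis
      by (simp add: F_def frob_mult[OF M Q_def] matrix_vector_right_distrib vector_scalar_commute)
  qed
  have nz: "F v $ 1 \<noteq> 0 \<or> F v $ 2 \<noteq> 0" if "v \<noteq> 0" for v
    using F_nz[OF that] by (auto simp: vec_eq_iff forall_2)
  obtain f where f: "proj_endo d f"
    "\<And>v. v \<noteq> 0 \<Longrightarrow> f (proj_pt v) = proj_pt (vector [F v $ 1, F v $ 2])"
    using proj_endo_of_forms[OF form[of 1] form[of 2] nz] by blast
  have vec: "vector [w $ 1, w $ 2] = w" for w :: "'k ^ 2" by (simp add: vec_eq_iff forall_2)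
  show ?thesis
  proof (rule that[OF d f(1)])
    fix M and x :: "'k proj_line" assume M: "M \<in> G"
    obtain v where v: "v \<noteq> 0" "x = proj_pt v" by (rule proj_pt_cases)
    then show "f (pgl_act (pgl M) x) = pgl_act (pgl M) (f x)"
      using M by (simp add: pgl_act_pgl f(2) vec invertible_mult_nonzero G_invertible
          F_nz F_equivariant)
  next
    fix v :: "'k ^ 2" assume v: "v \<noteq> 0"
    have "f (proj_pt v) = proj_pt v \<longleftrightarrow> wedge (F v) v = 0"
      using v by (simp add: f(2) vec wedge_eq_0_iff_proj_pt F_nz)
    then show "f (proj_pt v) = proj_pt v \<longleftrightarrow>
        rational_form (q ^ 2) v = 0 \<or> (\<exists>M\<in>G. wedge t (M *v v) = 0)"
      using Q by (auto simp: wedge_F b_def orbit_form_eq_0_iff Q_def)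
  qed
qed

end

section \<open>Realizing finite groups as automorphism groups\<close>

text \<open>
  One Frobenius period is common to the entries of representatives of all classes in \<open>\<Gamma>\<close>; the lift
  \<open>G\<close> is the full preimage of \<open>\<Gamma>\<close> in the general linear group over the resulting finite field. The
  set \<open>S\<close> allows the field to be made as large as desired.
\<close>

lemma pgl_finite_frobenius_lift:
  fixes \<Gamma> :: "('k::alg_closed_field ^ 2 ^ 2) set set" and S :: "'k set"
  assumes prime: "prime CHAR('k)"
    and periodic: "\<And>a :: 'k. \<exists>k>0. a ^ (CHAR('k) ^ k) = a"
    and \<Gamma>: "subgroup \<Gamma> PGL2" "finite \<Gamma>"
    and S: "finite S"
  obtains k q G where "finite_frobenius_group k q G" "pgl ` G = \<Gamma>" "\<And>a. a \<in> S \<Longrightarrow> a ^ q = a"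
proof -
  have "\<exists>R. invertible R \<and> pgl R = \<gamma>" if "\<gamma> \<in> \<Gamma>" for \<gamma>
    using that subgroup.subset[OF \<Gamma>(1)] by (auto simp: carrier_PGL2)
  then obtain R where R: "\<And>\<gamma>. \<gamma> \<in> \<Gamma> \<Longrightarrow> invertible (R \<gamma>) \<and> pgl (R \<gamma>) = \<gamma>" by metis
  define E where "E = S \<union> (\<lambda>(\<gamma>, i, j). R \<gamma> $ i $ j) ` (\<Gamma> \<times> UNIV)"
  have "finite E" unfolding E_def using S \<Gamma>(2) by simp
  then obtain k where k: "k > 0" "\<forall>a\<in>E. a ^ (CHAR('k) ^ k) = a"
    using common_frobenius_period[of E "CHAR('k)"] periodic by blast
  define q where "q = CHAR('k) ^ k"
  define G where "G = {M. invertible M \<and> (\<forall>i j. M $ i $ j ^ q = M $ i $ j) \<and> pgl M \<in> \<Gamma>}"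
  have "2 \<le> CHAR('k)" using prime by (rule prime_ge_2_nat)
  moreover have "CHAR('k) \<le> q"
    unfolding q_def using k(1) \<open>2 \<le> CHAR('k)\<close> by (intro self_le_power) auto
  ultimately have "q \<ge> 2" by simp
  have "finite {M :: 'k ^ 2 ^ 2. \<forall>i. M $ i \<in> {v. \<forall>j. v $ j \<in> {a. a ^ q = a}}}"
    by (intro finite_vec2 finite_power_fixed[OF \<open>q \<ge> 2\<close>])
  then have "finite G" by (rule rev_finite_subset) (auto simp: G_def)
  moreover have "M ** N \<in> G" if "M \<in> G" "N \<in> G" for M N
  proof -
    have "(M ** N) $ i $ j ^ q = (M ** N) $ i $ j" for i j
      using that by (simp add: matrix_matrix_mult_def UNIV_2 G_def power_mult_distrib
          freshmans_dream'[OF prime q_def])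
    then show ?thesis using that subgroup.m_closed[OF \<Gamma>(1)]
      by (auto simp: G_def invertible_mult simp flip: pgl_mult)
  qed
  ultimately have "finite_frobenius_group k q G"
    using prime k(1) q_def by unfold_locales (auto simp: G_def)
  moreover have "pgl ` G = \<Gamma>"
  proof
    show "\<Gamma> \<subseteq> pgl ` G"
    proof
      fix \<gamma> assume \<gamma>: "\<gamma> \<in> \<Gamma>"
      have "R \<gamma> $ i $ j \<in> E" for i j
        unfolding E_def using \<gamma> by (intro UnI2 image_eqI[of _ _ "(\<gamma>, i, j)"]) auto
      with R[OF \<gamma>] \<gamma> k show "\<gamma> \<in> pgl ` G"
        by (intro image_eqI[of _ _ "R \<gamma>"]) (auto simp: G_def q_def)
    qed
  qed (auto simp: G_def)
  moreover have "a ^ q = a" if "a \<in> S" for a using that k by (simp add: E_def q_def)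
  ultimately show ?thesis using that by blast
qed

lemma inj_affine_point: "inj (\<lambda>a :: 'k::field. proj_pt (vector [a, 1]))"
proof (rule injI)
  fix a b :: 'k assume eq: "proj_pt (vector [a, 1] :: 'k ^ 2) = proj_pt (vector [b, 1])"
  have "(vector [e, 1] :: 'k ^ 2) \<noteq> 0" for e by (simp add: vec_eq_iff forall_2)
  then have "wedge (vector [a, 1] :: 'k ^ 2) (vector [b, 1]) = 0"
    using eq wedge_eq_0_iff_proj_pt by blast
  then show "a = b" by (simp add: wedge_def)
qed

text \<open>
  The assumptions say that the field is an algebraic extension of its prime field, of positive
  characteristic. The set \<open>S\<close> in the proof forces the projective line \<open>T\<close> over the field with \<open>Q\<close>
  elements to be large enough for the rigidity of \<open>T \<union> \<Gamma>\<tau>\<close>, which becomes the fixed point set of \<open>f\<close>.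
\<close>

theorem finite_subgroup_is_Aut:
  fixes \<Gamma> :: "('k::alg_closed_field ^ 2 ^ 2) set set"
  assumes prime: "prime CHAR('k)"
    and periodic: "\<And>a :: 'k. \<exists>k>0. a ^ (CHAR('k) ^ k) = a"
    and \<Gamma>: "subgroup \<Gamma> PGL2" "finite \<Gamma>"
  shows "\<exists>d (f :: 'k proj_line \<Rightarrow> 'k proj_line). 2 \<le> d \<and> proj_endo d f \<and> Aut f = \<Gamma>"
proof -
  have sub: "\<Gamma> \<subseteq> carrier PGL2" by (rule subgroup.subset[OF \<Gamma>(1)])
  obtain S :: "'k set" where S: "finite S" "card S = card \<Gamma> + 3"
    using infinite_arbitrarily_large[OF infinite_UNIV_alg_closed] by metis
  obtain k q G where "finite_frobenius_group k q G" and G: "pgl ` G = \<Gamma>"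
    and Sq: "\<And>a. a \<in> S \<Longrightarrow> a ^ q = a"
    using pgl_finite_frobenius_lift[OF prime periodic \<Gamma> S(1)] by metis
  interpret finite_frobenius_group k q G by fact
  define Q where "Q = q ^ 2"
  have "2 * 2 \<le> q * q" using q_ge_2 by (intro mult_le_mono)
  then have Q: "Q \<ge> 2" by (simp add: Q_def power2_eq_square)
  define T where "T = {proj_pt v | v :: 'k ^ 2. v \<noteq> 0 \<and> rational_form Q v = 0}"
  have "T \<subseteq> proj_pt ` {u. frob Q u = u}"
  proof
    fix x assume "x \<in> T"
    then obtain v where v: "v \<noteq> 0" "rational_form Q v = 0" "x = proj_pt v" by (auto simp: T_def)
    then obtain c u where u: "frob Q u = u" "u \<noteq> 0" "v = c *s u"
      using rational_form_eq_0_iff[of Q v] Q by auto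
    with v have "c \<noteq> 0" by auto
    with v u have "proj_pt u = x" using proj_pt_eq_iff by blast
    with u show "x \<in> proj_pt ` {u. frob Q u = u}" by blast
  qed
  then have finT: "finite T" using finite_frob_fixed[OF Q] finite_surj by blast
  have "(\<lambda>a. proj_pt (vector [a, 1])) ` S \<subseteq> T"
  proof
    fix x assume "x \<in> (\<lambda>a. proj_pt (vector [a, 1])) ` S"
    then obtain a where a: "a \<in> S" "x = proj_pt (vector [a, 1])" by blast
    have "frob Q (vector [a, 1] :: 'k ^ 2) = vector [a, 1]"
      unfolding Q_def
      by (rule frob_square_fixed) (simp add: Sq[OF a(1)] frob_def vec_eq_iff forall_2)
    then have "rational_form Q (vector [a, 1]) = 0" by (simp add: rational_form_def)
    moreover have "(vector [a, 1] :: 'k ^ 2) \<noteq> 0" by (simp add: vec_eq_iff forall_2)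
    ultimately show "x \<in> T" using a by (auto simp: T_def)
  qed
  then have cardT: "card T \<ge> card \<Gamma> + 3"
    using card_mono[OF finT] card_image[OF inj_on_subset[OF inj_affine_point subset_UNIV], of S]
      S(2) by metis
  obtain E where E: "finite E"
    "\<And>t \<alpha>. t \<notin> E \<Longrightarrow> \<alpha> \<in> carrier PGL2 \<Longrightarrow>
      pgl_act \<alpha> ` (T \<union> (\<lambda>\<gamma>. pgl_act \<gamma> t) ` \<Gamma>) \<subseteq> T \<union> (\<lambda>\<gamma>. pgl_act \<gamma> t) ` \<Gamma> \<Longrightarrow> \<alpha> \<in> \<Gamma>"
    using generic_orbit_rigidifies[OF \<Gamma> finT cardT] by blast
  have "infinite (UNIV :: 'k proj_line set)"
    using finite_imageD[OF _ inj_affine_point] infinite_UNIV_alg_closed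
    by (metis finite_subset subset_UNIV)
  moreover have "finite (T \<union> E)" using finT E(1) by simp
  ultimately obtain \<tau> where \<tau>: "\<tau> \<notin> T \<union> E" using ex_new_if_finite by blast
  obtain t where t: "t \<noteq> 0" "\<tau> = proj_pt t" by (rule proj_pt_cases)
  have "rational_form (q ^ 2) t \<noteq> 0" using \<tau> t by (auto simp: T_def Q_def)
  then obtain d f where df: "2 \<le> d" "proj_endo d f"
    and equivariant: "\<And>M x. M \<in> G \<Longrightarrow> f (pgl_act (pgl M) x) = pgl_act (pgl M) (f x)"
    and fixed: "\<And>v. v \<noteq> 0 \<Longrightarrow> f (proj_pt v) = proj_pt v \<longleftrightarrow>
       rational_form (q ^ 2) v = 0 \<or> (\<exists>M\<in>G. wedge t (M *v v) = 0)"
    by (rule exists_equivariant_endo_with_fixed_points) blast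
  have orbit: "(\<exists>M\<in>G. wedge t (M *v v) = 0) \<longleftrightarrow> proj_pt v \<in> (\<lambda>\<gamma>. pgl_act \<gamma> \<tau>) ` \<Gamma>"
    if v: "v \<noteq> 0" for v
  proof -
    have "(\<exists>M\<in>G. wedge t (M *v v) = 0) \<longleftrightarrow> (\<exists>M\<in>G. \<tau> = pgl_act (pgl M) (proj_pt v))"
      using v t by (intro bex_cong) (auto simp: wedge_eq_0_iff_proj_pt pgl_act_pgl
          invertible_mult_nonzero G_invertible)
    also have "\<dots> \<longleftrightarrow> (\<exists>\<gamma>\<in>\<Gamma>. \<tau> = pgl_act \<gamma> (proj_pt v))" unfolding G[symmetric] by blast
    also have "\<dots> \<longleftrightarrow> (\<exists>\<gamma>\<in>\<Gamma>. proj_pt v = pgl_act \<gamma> \<tau>)"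
    proof safe
      fix \<gamma> assume \<gamma>: "\<gamma> \<in> \<Gamma>"
      then have inv: "inv\<^bsub>PGL2\<^esub> \<gamma> \<in> \<Gamma>" "\<gamma> \<in> carrier PGL2"
        using subgroup.m_inv_closed[OF \<Gamma>(1)] sub by blast+
      show "\<exists>\<delta>\<in>\<Gamma>. proj_pt v = pgl_act \<delta> (pgl_act \<gamma> (proj_pt v))"
        by (rule bexI[OF _ inv(1)]) (simp add: pgl_act_inv(1)[OF inv(2)])
      assume "proj_pt v = pgl_act \<gamma> \<tau>"
      then show "\<exists>\<delta>\<in>\<Gamma>. \<tau> = pgl_act \<delta> (proj_pt v)"
        by (intro bexI[OF _ inv(1)]) (simp add: pgl_act_inv(1)[OF inv(2)])
    qed
    finally show ?thesis by blast
  qed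
  have Fix: "f x = x \<longleftrightarrow> x \<in> T \<union> (\<lambda>\<gamma>. pgl_act \<gamma> \<tau>) ` \<Gamma>" for x
  proof -
    obtain v where v: "v \<noteq> 0" "x = proj_pt v" by (rule proj_pt_cases)
    have "rational_form Q v = 0 \<longleftrightarrow> proj_pt v \<in> T"
    proof
      assume "proj_pt v \<in> T"
      then obtain w where w: "w \<noteq> 0" "rational_form Q w = 0" "proj_pt w = proj_pt v"
        by (auto simp: T_def)
      with v obtain c where "v = c *s w" using proj_pt_eq_iff by blast
      with w show "rational_form Q v = 0" by (simp add: rational_form_scale)
    qed (use v in \<open>auto simp: T_def\<close>)
    with fixed[OF v(1)] orbit[OF v(1)] v show ?thesis by (simp add: Q_def)
  qed
  have "Aut f = \<Gamma>"
  proof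
    show "Aut f \<subseteq> \<Gamma>"
    proof
      fix \<alpha> assume "\<alpha> \<in> Aut f"
      then have \<alpha>: "\<alpha> \<in> carrier PGL2" "\<And>x. f (pgl_act \<alpha> x) = pgl_act \<alpha> (f x)"
        by (auto simp: Aut_iff_commute)
      show "\<alpha> \<in> \<Gamma>"
      proof (rule E(2)[of \<tau>])
        show "pgl_act \<alpha> ` (T \<union> (\<lambda>\<gamma>. pgl_act \<gamma> \<tau>) ` \<Gamma>) \<subseteq> T \<union> (\<lambda>\<gamma>. pgl_act \<gamma> \<tau>) ` \<Gamma>"
          using \<alpha>(2) by (metis Fix image_subsetI)
      qed (use \<tau> \<alpha> in auto)
    qed
    show "\<Gamma> \<subseteq> Aut f"
      using sub equivariant G by (auto simp: Aut_iff_commute)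
  qed
  with df show ?thesis by blast
qed

theorem theorem1p1:
  fixes p :: nat and \<Gamma> :: "('f::field alg_closure ^ 2 ^ 2) set set"
  assumes "prime p"
    and "CARD('f) = p"
    and "subgroup \<Gamma> PGL2" and "finite \<Gamma>"
  shows "\<exists>d (f :: 'f alg_closure proj_line \<Rightarrow> 'f alg_closure proj_line).
           2 \<le> d \<and> proj_endo d f \<and> Aut f = \<Gamma>"
proof (rule finite_subgroup_is_Aut)
  have prime: "prime CARD('f)" using assms(1) unfolding assms(2) .
  have char: "CHAR('f alg_closure) = CARD('f)"
    unfolding CHAR_alg_closure by (rule CHAR_eq_CARD[OF prime])
  show "prime CHAR('f alg_closure)" unfolding char by (rule prime)
  show "\<exists>k>0. a ^ (CHAR('f alg_closure) ^ k) = a" for a :: "'f alg_closure"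
    unfolding char by (rule frobenius_periodic_alg_closure[OF prime])
  show "subgroup \<Gamma> PGL2" "finite \<Gamma>" by (rule assms(3), rule assms(4))
qed

end
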